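(* A set $R\subset \mathbb{N}$ is a set of nice recurrence if and only if it is $(\{0,\dots,N-1\})$-nicely intersective.
   Context: $\mathbb{N}=\{0,1,2,\dots\}$. A measure preserving system $(X,\mu,T)$ consists of a probability space $(X,\mu)$ (the $\sigma$-algebra is suppressed from the notation) and a measurable map $T:X\to X$ with $\mu(T^{-1}B)=\mu(B)$ for all measurable $B\subset X$; $T$ is not assumed invertible and the system is not assumed ergodic. A set $R\subset\mathbb{N}$ is called a set of nice recurrence if for any measure preserving system $(X,\mu,T)$, any measurable $A\subset X$, and any $\varepsilon>0$ there exists some non-zero $r\in R$ such that $\mu(A\cap T^{-r}A)>\mu(A)^2-\varepsilon$. For $E\subset\mathbb{N}$ and $n\in\mathbb{N}$, $E-n:=\{m\in\mathbb{N} : m+n\in E\}$. The upper density of $E$ with respect to the sequence $(\{0,\dots,N-1\})$ is \[\overline{d}(E):=\limsup_{N\to\infty}\frac{|E\cap\{0,1,\dots,N-1\}|}{N}.\] A set $R\subset\mathbb{N}$ is called $(\{0,\dots,N-1\})$-nicely intersective if for any set $E\subset\mathbb{N}$ and any $\varepsilon>0$ there exists some non-zero $r\in R$ such that $\overline{d}(E\cap(E-r))>\overline{d}(E)^2-\varepsilon$. *)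

theory Defs
  imports "HOL-Probability.Probability"
begin

text \<open>The space \<open>X\<close> is \<open>space M\<close>, so preimages are intersected with \<open>space M\<close>.\<close>

definition measure_preserving_system :: "'a measure \<Rightarrow> ('a \<Rightarrow> 'a) \<Rightarrow> bool" where
  "measure_preserving_system M T \<longleftrightarrow>
     prob_space M \<and> T \<in> measurable M M \<and>
     (\<forall>B\<in>sets M. measure M (T -` B \<inter> space M) = measure M B)"

text \<open>
  HOL cannot quantify over types inside a formula, so the type in which the points of
  the systems live is a parameter. The \<open>\<sigma>\<close>-algebra, its underlying set and the measure are
  arbitrary within that type. A set of nice recurrence is one for which this predicate
  holds for every type. As the condition on \<open>(M, T, A)\<close> depends only on the factor on
  \<open>{0,1}^\<nat>\<close> given by the itinerary \<open>x \<mapsto> (n \<mapsto> T^n x \<in> A)\<close>,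
  it suffices that it holds for \<open>nat \<Rightarrow> bool\<close>.
\<close>

definition nice_recurrence :: "'a itself \<Rightarrow> nat set \<Rightarrow> bool" where
  "nice_recurrence _ R \<longleftrightarrow>
     (\<forall>(M :: 'a measure) T A \<epsilon>.
        measure_preserving_system M T \<longrightarrow> A \<in> sets M \<longrightarrow> (0::real) < \<epsilon> \<longrightarrow>
        (\<exists>r\<in>R. r \<noteq> 0 \<and>
           measure M (A \<inter> ((T ^^ r) -` A \<inter> space M)) > (measure M A)\<^sup>2 - \<epsilon>))"

definition shift_down :: "nat set \<Rightarrow> nat \<Rightarrow> nat set" where
  "shift_down E n = {m. m + n \<in> E}"

text \<open>The library's \<open>limsup\<close> needs a complete lattice, hence \<open>ereal\<close>; the value is always
  finite, see \<open>ereal_upper_density\<close>.\<close>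

definition upper_density :: "nat set \<Rightarrow> real" where
  "upper_density E =
     real_of_ereal (limsup (\<lambda>N. ereal (real (card (E \<inter> {0..<N})) / real N)))"

lemma ereal_upper_density:
  "ereal (upper_density E) = limsup (\<lambda>N. ereal (real (card (E \<inter> {0..<N})) / real N))"
proof -
  let ?f = "\<lambda>N. ereal (real (card (E \<inter> {0..<N})) / real N)"
  have "card (E \<inter> {0..<N}) \<le> N" for N
    using card_mono[of "{0..<N}" "E \<inter> {0..<N}"] by simp
  then have "?f N \<le> 1" for N
    by (auto simp: divide_le_eq_1)
  then have "limsup ?f \<le> 1"
    by (intro Limsup_bounded always_eventually allI)
  moreover have "0 \<le> limsup ?f"
    by (intro le_Limsup always_eventually allI) auto
  ultimately have "\<bar>limsup ?f\<bar> \<noteq> \<infinity>"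
    by auto
  then show ?thesis
    unfolding upper_density_def by (rule ereal_real')
qed

definition nicely_intersective :: "nat set \<Rightarrow> bool" where
  "nicely_intersective R \<longleftrightarrow>
     (\<forall>E \<epsilon>. (0::real) < \<epsilon> \<longrightarrow>
        (\<exists>r\<in>R. r \<noteq> 0 \<and>
           upper_density (E \<inter> shift_down E r) > (upper_density E)\<^sup>2 - \<epsilon>))"

end

theory Submission
  imports Defs "HOL-Library.Discrete_Functions" "HOL-Real_Asymp.Real_Asymp"
begin

text \<open>
  The equivalence holds because sets of integers and measure preserving systems can be traded for
  each other without changing the quantities that the two recurrence notions compare.

  From sets to systems, this is Furstenberg's correspondence (\<open>furstenberg_correspondence\<close>): the
  frequencies of finite patterns in a set \<open>E\<close>, taken along a sequence of windows that realizes the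
  upper density, converge after passing to a subsequence, and the limits define a shift invariant
  probability measure on \<open>{0,1}^\<nat>\<close>. The event \<open>A = {x. x 0}\<close> has the upper density of \<open>E\<close> as its
  measure, and the return probability of \<open>A\<close> after \<open>r\<close> steps is at most the upper density of
  \<open>E \<inter> (E - r)\<close>.

  From systems to sets, the correspondence has an inverse
  (\<open>inverse_furstenberg_correspondence\<close>): for any \<open>(M, T)\<close> and \<open>A\<close> there is a set \<open>E\<close> for which
  the density of \<open>E \<inter> (E - r)\<close> equals the measure of \<open>A \<inter> T^-r A\<close>, for all \<open>r\<close> at once. The set
  is a concatenation of itineraries of longer and longer orbit segments. If the starting points
  were drawn independently from the measure, the law of large numbers would give the densities
  almost surely; \<open>exists_balanced_sequence\<close> picks points one after the other that imitate such a
  sample. Since \<open>r = 0\<close> is included, the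
  density of \<open>E\<close> itself is the measure of \<open>A\<close>.

  An \<open>r\<close> that is good on one side is then good on the other side with the same \<open>\<epsilon>\<close>.
\<close>

section \<open>From sets of integers to systems\<close>

text \<open>
  For a countable index type, \<open>[0,1]^'a\<close> is metrizable and, by Tychonoff, compact; so it is
  sequentially compact.
\<close>

lemma pointwise_convergent_subsequence:
  fixes f :: "nat \<Rightarrow> 'a::countable \<Rightarrow> real"
  assumes "\<And>n a. f n a \<in> {0..1}"
  obtains \<rho> l where "strict_mono \<rho>" "\<And>a. (\<lambda>k. f (\<rho> k) a) \<longlonglongrightarrow> l a"
proof -
  define K :: "('a \<Rightarrow> real) set" where "K = PiE UNIV (\<lambda>_. {0..1})"
  have "compactin (product_topology (\<lambda>_::'a. euclidean) UNIV) K"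
    unfolding K_def compactin_PiE by (simp add: compactin_euclidean_iff)
  then have "compact K"
    by (simp add: euclidean_product_topology compactin_euclidean_iff)
  then have "seq_compact K"
    by (simp add: compact_imp_seq_compact)
  note subseq = this[unfolded seq_compact_def, THEN spec[of _ f], THEN mp]
  have "\<forall>n. f n \<in> K"
    using assms by (auto simp: K_def)
  from subseq[OF this]
  obtain l \<rho> where \<rho>: "strict_mono \<rho>" and l: "(f \<circ> \<rho>) \<longlonglongrightarrow> l"
    by (elim bexE exE conjE)
  have "(\<lambda>k. f (\<rho> k) a) \<longlonglongrightarrow> l a" for a
  proof -
    have "isCont (\<lambda>x :: 'a \<Rightarrow> real. x a) l"
      by (rule continuous_on_interior[OF continuous_on_product_coordinates]) simp
    from isCont_tendsto_compose[OF this l] show ?thesis by simp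
  qed
  with \<rho> show thesis by (rule that)
qed

text \<open>
  The events that mention only finitely many coordinates are exactly the clopen sets of the
  Cantor space \<open>{0,1}^\<nat>\<close>. The prefix form exhibits each of them as a finite union of cylinders
  over words of one length, hence the family as countable.
\<close>

definition determined_by_prefix :: "nat \<Rightarrow> (nat \<Rightarrow> bool) set \<Rightarrow> bool" where
  "determined_by_prefix n S \<longleftrightarrow> (\<forall>x y. (\<forall>i<n. x i = y i) \<longrightarrow> (x \<in> S \<longleftrightarrow> y \<in> S))"

definition clopens :: "(nat \<Rightarrow> bool) set set" where
  "clopens = {S. \<exists>n. determined_by_prefix n S}"

lemma determined_by_prefixD:
  "determined_by_prefix n S \<Longrightarrow> (\<And>i. i < n \<Longrightarrow> x i = y i) \<Longrightarrow> x \<in> S \<longleftrightarrow> y \<in> S"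
  by (simp add: determined_by_prefix_def)

lemma determined_by_prefix_mono:
  assumes "determined_by_prefix n S" "n \<le> m"
  shows "determined_by_prefix m S"
  unfolding determined_by_prefix_def
proof (intro allI impI)
  fix x y :: "nat \<Rightarrow> bool" assume "\<forall>i<m. x i = y i"
  then show "x \<in> S \<longleftrightarrow> y \<in> S"
    using assms(2) by (intro determined_by_prefixD[OF assms(1)]) simp
qed

lemma clopens_Un:
  assumes "S \<in> clopens" "S' \<in> clopens"
  shows "S \<union> S' \<in> clopens"
proof -
  obtain n m where "determined_by_prefix n S" "determined_by_prefix m S'"
    using assms by (auto simp: clopens_def)
  then have "determined_by_prefix (max n m) S" "determined_by_prefix (max n m) S'"
    by (auto intro: determined_by_prefix_mono)
  then have "determined_by_prefix (max n m) (S \<union> S')"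
    unfolding determined_by_prefix_def Un_iff by (intro allI impI arg_cong2[where f = "(\<or>)"]) auto
  then show ?thesis
    by (auto simp: clopens_def)
qed

lemma clopens_Compl: "S \<in> clopens \<Longrightarrow> - S \<in> clopens"
  by (auto simp: clopens_def determined_by_prefix_def)

lemma clopens_empty: "{} \<in> clopens"
  by (auto simp: clopens_def determined_by_prefix_def)

lemma clopens_coordinate: "{x. x i} \<in> clopens"
  by (auto simp: clopens_def determined_by_prefix_def intro!: exI[of _ "Suc i"])

lemma algebra_clopens: "algebra UNIV clopens"
  unfolding algebra_iff_Un
  using clopens_Un clopens_Compl clopens_empty by (auto simp: Compl_eq_Diff_UNIV[symmetric])

lemma clopens_closed:
  assumes "S \<in> clopens"
  shows "closed S"
proof -
  have "open S" if "determined_by_prefix n S" for n S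
  proof (subst open_subopen, rule ballI)
    fix x assume "x \<in> S"
    let ?U = "PiE UNIV (\<lambda>i. if i < n then {x i} else UNIV)"
    have "open ?U"
      by (rule open_PiE) (auto intro: discrete_topology_class.open_discrete finite_subset[of _ "{..<n}"])
    moreover have "x \<in> ?U" by auto
    moreover have "?U \<subseteq> S"
    proof
      fix y assume "y \<in> ?U"
      then have "\<forall>i<n. x i = y i" by (auto simp: PiE_iff split: if_splits)
      then show "y \<in> S"
        using determined_by_prefixD[OF that, of x y] \<open>x \<in> S\<close> by simp
    qed
    ultimately show "\<exists>T. open T \<and> x \<in> T \<and> T \<subseteq> S" by blast
  qed
  then show ?thesis
    using clopens_Compl[OF assms] unfolding clopens_def closed_def by blast
qed

text \<open>
  By compactness, a finitely additive content on the clopen sets is continuous at the empty set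
  for a trivial reason: a decreasing sequence with empty intersection reaches the empty set.
\<close>

lemma clopens_decseq_empty:
  fixes S :: "nat \<Rightarrow> (nat \<Rightarrow> bool) set"
  assumes "range S \<subseteq> clopens" "decseq S" "(\<Inter>i. S i) = {}"
  obtains n where "S n = {}"
proof -
  have "compactin (product_topology (\<lambda>_::nat. euclidean :: bool topology) UNIV) (PiE UNIV (\<lambda>_. UNIV))"
    unfolding compactin_PiE by (simp add: compactin_euclidean_iff finite_imp_compact)
  then have "compact (UNIV :: (nat \<Rightarrow> bool) set)"
    by (simp add: euclidean_product_topology compactin_euclidean_iff)
  note cpt = this
  have cl: "closed (S i)" for i
    using assms(1) by (intro clopens_closed) auto
  obtain I where I: "finite I" "(\<Inter>i\<in>I. S i) = {}"
  proof (rule ccontr)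
    assume none: "\<not> thesis"
    have "UNIV \<inter> (\<Inter>i\<in>UNIV. S i) \<noteq> {}"
    proof (rule compact_imp_fip_image[OF cpt cl])
      fix I :: "nat set" assume "finite I"
      show "UNIV \<inter> (\<Inter>i\<in>I. S i) \<noteq> {}"
      proof
        assume "UNIV \<inter> (\<Inter>i\<in>I. S i) = {}"
        then have thesis
          by (intro that[OF \<open>finite I\<close>]) (simp only: Int_UNIV_left)
        with none show False ..
      qed
    qed
    then show False
      by (simp only: Int_UNIV_left assms(3))
  qed
  have "S (Max (insert 0 I)) \<subseteq> S i" if "i \<in> I" for i
    by (rule decseqD[OF assms(2)]) (simp add: I(1) that)
  then have "S (Max (insert 0 I)) \<subseteq> (\<Inter>i\<in>I. S i)"
    by (rule INT_greatest)
  then show thesis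
    using I(2) by (intro that) auto
qed

text \<open>
  The empirical measure of the first \<open>N\<close> points of the shift orbit of the indicator of \<open>E\<close>.
\<close>

definition orbit_frequency :: "nat set \<Rightarrow> nat \<Rightarrow> (nat \<Rightarrow> bool) set \<Rightarrow> real" where
  "orbit_frequency E N S = card {n \<in> {0..<N}. (\<lambda>i. n + i \<in> E) \<in> S} / N"

lemma orbit_frequency_bounds: "orbit_frequency E N S \<in> {0..1}"
proof -
  have "card {n \<in> {0..<N}. (\<lambda>i. n + i \<in> E) \<in> S} \<le> card {0..<N}"
    by (rule card_mono) auto
  then show ?thesis
    by (auto simp: orbit_frequency_def divide_le_eq_1)
qed

lemma orbit_frequency_Un:
  assumes "S \<inter> S' = {}"
  shows "orbit_frequency E N (S \<union> S') = orbit_frequency E N S + orbit_frequency E N S'"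
proof -
  have "{n \<in> {0..<N}. (\<lambda>i. n + i \<in> E) \<in> S \<union> S'} =
      {n \<in> {0..<N}. (\<lambda>i. n + i \<in> E) \<in> S} \<union> {n \<in> {0..<N}. (\<lambda>i. n + i \<in> E) \<in> S'}"
    by auto
  moreover have "card \<dots> = card {n \<in> {0..<N}. (\<lambda>i. n + i \<in> E) \<in> S}
      + card {n \<in> {0..<N}. (\<lambda>i. n + i \<in> E) \<in> S'}"
    using assms by (intro card_Un_disjoint) auto
  ultimately show ?thesis
    by (simp add: orbit_frequency_def add_divide_distrib)
qed

lemma orbit_frequency_UN:
  assumes "finite W" "disjoint_family_on S W"
  shows "orbit_frequency E N (\<Union>w\<in>W. S w) = (\<Sum>w\<in>W. orbit_frequency E N (S w))"
  using assms
proof (induction W)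
  case empty
  show ?case by (simp add: orbit_frequency_def)
next
  case (insert w W)
  have "S w \<inter> (\<Union>w\<in>W. S w) = {}"
    using insert.prems insert.hyps(2) by (auto simp: disjoint_family_on_def)
  then show ?case
    using insert by (simp add: orbit_frequency_Un disjoint_family_on_insert)
qed

definition left_shift :: "(nat \<Rightarrow> bool) \<Rightarrow> nat \<Rightarrow> bool" where
  "left_shift x = (\<lambda>i. x (Suc i))"

lemma left_shift_pow: "(left_shift ^^ r) x = (\<lambda>i. x (r + i))"
  by (induction r arbitrary: x) (simp_all add: left_shift_def funpow_Suc_right del: funpow.simps)

lemma left_shift_vimage_clopens:
  assumes "S \<in> clopens"
  shows "left_shift -` S \<in> clopens"
proof -
  obtain n where "determined_by_prefix n S"
    using assms by (auto simp: clopens_def)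
  then have "determined_by_prefix (Suc n) (left_shift -` S)"
    unfolding determined_by_prefix_def left_shift_def by auto
  then show ?thesis by (auto simp: clopens_def)
qed

text \<open>
  Shifting the event moves the window \<open>{0..<N}\<close> by one, which adds at most one time and drops
  at most one. This makes every limit of empirical measures shift invariant.
\<close>

lemma orbit_frequency_left_shift:
  "\<bar>orbit_frequency E N (left_shift -` S) - orbit_frequency E N S\<bar> \<le> 1 / N"
proof -
  let ?P = "\<lambda>n. (\<lambda>i. n + i \<in> E) \<in> S"
  have c: "card {n \<in> {0..<N}. P n} = (\<Sum>n<N. of_bool (P n))" for P
    by (simp add: sum_of_bool_eq Int_def atLeast0LessThan)
  have "(\<Sum>n<N. of_bool (?P (Suc n))) + of_bool (?P 0) = (\<Sum>n<Suc N. of_bool (?P n) :: nat)"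
    by (simp only: sum.lessThan_Suc_shift)
  then have "(\<Sum>n<N. of_bool (?P (Suc n))) + of_bool (?P 0)
       = (\<Sum>n<N. of_bool (?P n)) + (of_bool (?P N) :: nat)"
    by simp
  then have "card {n \<in> {0..<N}. ?P (Suc n)} + of_bool (?P 0) = card {n \<in> {0..<N}. ?P n} + of_bool (?P N)"
    unfolding c .
  then have "\<bar>real (card {n \<in> {0..<N}. ?P (Suc n)}) - real (card {n \<in> {0..<N}. ?P n})\<bar> \<le> 1"
    by (cases "?P 0"; cases "?P N") auto
  moreover have "{n \<in> {0..<N}. (\<lambda>i. n + i \<in> E) \<in> left_shift -` S} = {n \<in> {0..<N}. ?P (Suc n)}"
    by (simp add: left_shift_def)
  ultimately show ?thesis
    unfolding orbit_frequency_def
    by (simp add: diff_divide_distrib[symmetric] divide_right_mono)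
qed

text \<open>
  Only the countably many cylinders over finite words have to be made convergent; every other
  clopen set is a finite disjoint union of these.
\<close>

lemma orbit_frequency_convergent_subsequence:
  fixes s :: "nat \<Rightarrow> nat"
  obtains \<rho> \<phi> where "strict_mono \<rho>"
    "\<And>S. S \<in> clopens \<Longrightarrow> (\<lambda>k. orbit_frequency E (s (\<rho> k)) S) \<longlonglongrightarrow> \<phi> S"
proof -
  define C where "C w = {x :: nat \<Rightarrow> bool. map x [0..<length w] = w}" for w
  obtain \<rho> l where \<rho>: "strict_mono \<rho>"
    and l: "\<And>w. (\<lambda>k. orbit_frequency E (s (\<rho> k)) (C w)) \<longlonglongrightarrow> l w"
    by (rule pointwise_convergent_subsequence[of "\<lambda>k w. orbit_frequency E (s k) (C w)",
          OF orbit_frequency_bounds]) (rule that)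
  have "\<exists>L. (\<lambda>k. orbit_frequency E (s (\<rho> k)) S) \<longlonglongrightarrow> L" if "S \<in> clopens" for S
  proof -
    obtain n where n: "determined_by_prefix n S"
      using \<open>S \<in> clopens\<close> by (auto simp: clopens_def)
    define W where "W = (\<lambda>x. map x [0..<n]) ` S"
    have "finite W"
      by (rule finite_subset[OF _ finite_lists_length_eq[of UNIV n]]) (auto simp: W_def)
    moreover have "disjoint_family_on C W"
      by (auto simp: disjoint_family_on_def C_def W_def)
    moreover have "S = (\<Union>w\<in>W. C w)"
    proof (intro equalityI subsetI)
      fix y assume "y \<in> (\<Union>w\<in>W. C w)"
      then obtain x where "x \<in> S" "map y [0..<n] = map x [0..<n]"
        by (auto simp: W_def C_def)
      then show "y \<in> S"
        using determined_by_prefixD[OF n, of y x] by (simp add: map_eq_conv)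
    qed (auto simp: W_def C_def)
    ultimately have "orbit_frequency E N S = (\<Sum>w\<in>W. orbit_frequency E N (C w))" for N
      by (simp add: orbit_frequency_UN)
    moreover have "(\<lambda>k. \<Sum>w\<in>W. orbit_frequency E (s (\<rho> k)) (C w)) \<longlonglongrightarrow> (\<Sum>w\<in>W. l w)"
      by (intro tendsto_sum l)
    ultimately show ?thesis
      by (intro exI[of _ "\<Sum>w\<in>W. l w"]) simp
  qed
  then have "S \<in> clopens \<Longrightarrow>
      (\<lambda>k. orbit_frequency E (s (\<rho> k)) S) \<longlonglongrightarrow> lim (\<lambda>k. orbit_frequency E (s (\<rho> k)) S)" for S
    by (simp only: convergent_LIMSEQ_iff[symmetric] convergent_def)
  with \<rho> show thesis
    by (rule that)
qed

text \<open>
  Caratheodory's theorem; its continuity hypothesis is the compactness of the Cantor space.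
\<close>

lemma clopens_content_extends:
  fixes \<phi> :: "(nat \<Rightarrow> bool) set \<Rightarrow> real"
  assumes nonneg: "\<And>S. S \<in> clopens \<Longrightarrow> 0 \<le> \<phi> S"
    and empty: "\<phi> {} = 0" and total: "\<phi> UNIV = 1"
    and add: "\<And>S S'. S \<in> clopens \<Longrightarrow> S' \<in> clopens \<Longrightarrow> S \<inter> S' = {} \<Longrightarrow> \<phi> (S \<union> S') = \<phi> S + \<phi> S'"
  obtains M where "prob_space M" "space M = UNIV" "sets M = sigma_sets UNIV clopens"
    "\<And>S. S \<in> clopens \<Longrightarrow> measure M S = \<phi> S"
proof -
  interpret algebra UNIV clopens by (rule algebra_clopens)
  have "\<exists>\<mu> :: (nat \<Rightarrow> bool) set \<Rightarrow> ennreal. (\<forall>S\<in>clopens. \<mu> S = ennreal (\<phi> S)) \<and>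
          measure_space UNIV (sigma_sets UNIV clopens) \<mu>"
  proof (rule caratheodory_empty_continuous[where f = "\<lambda>S. ennreal (\<phi> S)"])
    show "positive clopens (\<lambda>S. ennreal (\<phi> S))"
      by (simp add: positive_def empty)
    show "additive clopens (\<lambda>S. ennreal (\<phi> S))"
      by (simp add: additive_def add nonneg)
    fix S :: "nat \<Rightarrow> (nat \<Rightarrow> bool) set"
    assume S: "range S \<subseteq> clopens" "decseq S" "(\<Inter>i. S i) = {}"
    then obtain n where "S n = {}" by (rule clopens_decseq_empty)
    then have "S i = {}" if "i \<ge> n" for i
      using S(2) that by (metis decseqD subset_empty)
    then show "(\<lambda>i. ennreal (\<phi> (S i))) \<longlonglongrightarrow> 0"
      by (intro tendsto_eventually eventually_sequentiallyI[of n]) (simp add: empty)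
  qed auto
  then obtain \<mu> where \<mu>: "\<And>S. S \<in> clopens \<Longrightarrow> \<mu> S = ennreal (\<phi> S)"
    and ms: "measure_space UNIV (sigma_sets UNIV clopens) \<mu>"
    by blast
  define M where "M = measure_of UNIV (sigma_sets UNIV clopens) \<mu>"
  have sets: "sets M = sigma_sets UNIV clopens" and space: "space M = UNIV"
    using ms by (auto simp: M_def measure_space_def sigma_algebra.sigma_sets_eq)
  have em: "emeasure M S = \<mu> S" if "S \<in> sigma_sets UNIV clopens" for S
    unfolding M_def using ms that
    by (intro emeasure_measure_of_sigma) (auto simp: measure_space_def)
  have em_clopen: "emeasure M S = ennreal (\<phi> S)" if "S \<in> clopens" for S
    using em \<mu> that by (simp add: sigma_sets.Basic)
  show thesis
  proof (rule that[OF _ space sets])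
    show "prob_space M"
      using em_clopen[of UNIV] by (intro prob_spaceI) (simp add: space total)
    show "measure M S = \<phi> S" if "S \<in> clopens" for S
      using em_clopen[OF that] nonneg[OF that] by (simp add: measure_def)
  qed
qed

text \<open>
  The clopen sets form a generator closed under intersections, so a probability measure and its
  image under the shift are equal once they agree there.
\<close>

lemma left_shift_measure_preserving:
  assumes M: "prob_space M" "space M = UNIV" "sets M = sigma_sets UNIV clopens"
    and inv: "\<And>S. S \<in> clopens \<Longrightarrow> measure M (left_shift -` S) = measure M S"
  shows "measure_preserving_system M left_shift"
proof -
  interpret prob_space M by fact
  interpret A: algebra UNIV clopens by (rule algebra_clopens)
  have meas: "left_shift \<in> measurable M M"
  proof (rule measurable_sigma_sets[OF M(3)])
    show "left_shift -` S \<inter> space M \<in> sets M" if "S \<in> clopens" for S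
      using left_shift_vimage_clopens[OF that] M by (simp add: sigma_sets.Basic)
  qed (auto simp: M)
  have "M = distr M M left_shift"
  proof (rule measure_eqI_generator_eq[where E = clopens and \<Omega> = UNIV and A = "\<lambda>_. UNIV"])
    show "Int_stable clopens"
      by (auto simp: Int_stable_def)
    show "emeasure M S = emeasure (distr M M left_shift) S" if "S \<in> clopens" for S
      using that meas inv[OF that] M
      by (simp add: emeasure_distr emeasure_eq_measure sigma_sets.Basic)
  qed (auto simp: M)
  then have "measure M (left_shift -` S \<inter> space M) = measure M S" if "S \<in> sets M" for S
    using measure_distr[OF meas that] by simp
  then show ?thesis
    using meas M(1) by (simp add: measure_preserving_system_def)
qed

text \<open>
  The measure is a limit of the empirical measures of \<open>E\<close>, taken along a subsequence of times
  that realizes the upper density of \<open>E\<close>. For the intersections \<open>E \<inter> (E - r)\<close> the same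
  subsequence gives only some limit point of the frequencies, hence the inequality.
\<close>

theorem furstenberg_correspondence:
  obtains M A where "measure_preserving_system M left_shift" "A \<in> sets M"
    "measure M A = upper_density E"
    "\<And>r. measure M (A \<inter> ((left_shift ^^ r) -` A \<inter> space M)) \<le> upper_density (E \<inter> shift_down E r)"
proof -
  define u where "u E N = ereal (real (card (E \<inter> {0..<N})) / real N)" for E :: "nat set" and N
  have ud: "ereal (upper_density E) = limsup (u E)" for E
    unfolding u_def by (rule ereal_upper_density)
  obtain s where s: "strict_mono s" and lim_s: "(u E \<circ> s) \<longlonglongrightarrow> limsup (u E)"
    using limsup_subseq_lim by blast
  obtain \<rho> \<phi> where \<rho>: "strict_mono \<rho>"
    and \<phi>: "\<And>S. S \<in> clopens \<Longrightarrow> (\<lambda>k. orbit_frequency E (s (\<rho> k)) S) \<longlonglongrightarrow> \<phi> S"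
    using orbit_frequency_convergent_subsequence[of E s] by blast
  define N where "N = s \<circ> \<rho>"
  have N: "strict_mono N" unfolding N_def using s \<rho> by (rule strict_mono_o)
  have lim_N: "(u E \<circ> N) \<longlonglongrightarrow> limsup (u E)"
    using LIMSEQ_subseq_LIMSEQ[OF lim_s \<rho>] by (simp add: N_def comp_assoc)
  have \<phi>: "(\<lambda>k. orbit_frequency E (N k) S) \<longlonglongrightarrow> \<phi> S" if "S \<in> clopens" for S
    using \<phi>[OF that] by (simp add: N_def)
  interpret algebra UNIV clopens by (rule algebra_clopens)
  \<comment> \<open>The empty window has frequency \<open>0 / 0 = 0\<close>, also for the full event.\<close>
  have pos: "\<forall>\<^sub>F k in sequentially. N k > 0"
    using eventually_gt_at_top[of 0]
    by eventually_elim (rule less_le_trans[OF _ seq_suble[OF N]])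
  have empty: "\<phi> {} = 0"
    using LIMSEQ_unique[OF \<phi>[OF clopens_empty], of 0] by (simp add: orbit_frequency_def)
  have total: "\<phi> UNIV = 1"
  proof (rule LIMSEQ_unique[OF \<phi>])
    show "(\<lambda>k. orbit_frequency E (N k) UNIV) \<longlonglongrightarrow> 1"
      using pos by (intro tendsto_eventually) (auto simp: orbit_frequency_def elim: eventually_mono)
  qed auto
  have nonneg: "0 \<le> \<phi> S" if "S \<in> clopens" for S
    using LIMSEQ_le_const[OF \<phi>[OF that], of 0] orbit_frequency_bounds by auto
  have add: "\<phi> (S \<union> S') = \<phi> S + \<phi> S'" if "S \<in> clopens" "S' \<in> clopens" "S \<inter> S' = {}" for S S'
  proof (rule LIMSEQ_unique[OF \<phi>])
    show "(\<lambda>k. orbit_frequency E (N k) (S \<union> S')) \<longlonglongrightarrow> \<phi> S + \<phi> S'"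
      unfolding orbit_frequency_Un[OF that(3)] using that by (intro tendsto_add \<phi>)
  qed (use that in auto)
  obtain M where M: "prob_space M" "space M = UNIV" "sets M = sigma_sets UNIV clopens"
    and M_eq: "\<And>S. S \<in> clopens \<Longrightarrow> measure M S = \<phi> S"
    using clopens_content_extends[of \<phi>] nonneg empty total add by blast
  have inv: "\<phi> (left_shift -` S) = \<phi> S" if S: "S \<in> clopens" for S
  proof -
    have "(\<lambda>k. 1 / real (N k)) \<longlonglongrightarrow> 0"
      using LIMSEQ_subseq_LIMSEQ[OF lim_1_over_n N] by (simp add: comp_def)
    then have "(\<lambda>k. orbit_frequency E (N k) (left_shift -` S) - orbit_frequency E (N k) S) \<longlonglongrightarrow> 0"
      by (rule Lim_null_comparison[rotated]) (simp add: orbit_frequency_left_shift)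
    moreover have "(\<lambda>k. orbit_frequency E (N k) (left_shift -` S) - orbit_frequency E (N k) S)
        \<longlonglongrightarrow> \<phi> (left_shift -` S) - \<phi> S"
      using S by (intro tendsto_diff \<phi> left_shift_vimage_clopens)
    ultimately show ?thesis
      using LIMSEQ_unique by fastforce
  qed
  let ?A = "{x. x 0} :: (nat \<Rightarrow> bool) set"
  let ?B = "\<lambda>r. {x. x 0 \<and> x r} :: (nat \<Rightarrow> bool) set"
  have B: "?B r \<in> clopens" for r
    using Int[OF clopens_coordinate[of 0] clopens_coordinate[of r]] by (simp add: Collect_conj_eq)
  have freq: "ereal (orbit_frequency E n (?B r)) = u (E \<inter> shift_down E r) n" for n r
  proof -
    have "{k \<in> {0..<n}. (\<lambda>i. k + i \<in> E) \<in> ?B r} = E \<inter> shift_down E r \<inter> {0..<n}"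
      by (auto simp: shift_down_def)
    then show ?thesis by (simp add: u_def orbit_frequency_def)
  qed
  have lim_B: "(u (E \<inter> shift_down E r) \<circ> N) \<longlonglongrightarrow> ereal (\<phi> (?B r))" for r
    unfolding comp_def freq[symmetric] by (simp add: \<phi>[OF B])
  show thesis
  proof (rule that[of M ?A])
    show "measure_preserving_system M left_shift"
      using inv M_eq left_shift_vimage_clopens by (intro left_shift_measure_preserving M) auto
    show "?A \<in> sets M"
      using M(3) clopens_coordinate by (auto intro: sigma_sets.Basic)
    have "E \<inter> shift_down E 0 = E"
      by (auto simp: shift_down_def)
    then have "ereal (\<phi> ?A) = ereal (upper_density E)"
      using LIMSEQ_unique[OF lim_N] lim_B[of 0] by (simp add: ud)
    then show "measure M ?A = upper_density E"
      using M_eq clopens_coordinate by simp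
    fix r
    have "ereal (\<phi> (?B r)) = limsup (u (E \<inter> shift_down E r) \<circ> N)"
      using lim_imp_Limsup[OF _ lim_B] by simp
    also have "\<dots> \<le> limsup (u (E \<inter> shift_down E r))"
      by (rule limsup_subseq_mono[OF N])
    finally have "\<phi> (?B r) \<le> upper_density (E \<inter> shift_down E r)"
      by (simp add: ud[symmetric])
    moreover have "?A \<inter> ((left_shift ^^ r) -` ?A \<inter> space M) = ?B r"
      by (auto simp: left_shift_pow M)
    ultimately show "measure M (?A \<inter> ((left_shift ^^ r) -` ?A \<inter> space M))
        \<le> upper_density (E \<inter> shift_down E r)"
      using M_eq[OF B] by simp
  qed
qed

section \<open>Choosing points that imitate independent samples\<close>

text \<open>
  The right-hand side bounds the expectation of the left-hand side: the cross terms
  \<open>2 * d i * Z i x\<close> have mean zero and \<open>Z i x\<close> has square at most \<open>c^2\<close>. A random variable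
  is somewhere at most its mean.
\<close>

lemma (in prob_space) exists_point_controlling_squares:
  fixes Z :: "'i \<Rightarrow> 'a \<Rightarrow> real"
  assumes "finite I" and w: "\<And>i. i \<in> I \<Longrightarrow> 0 \<le> w i"
    and Z: "\<And>i. i \<in> I \<Longrightarrow> Z i \<in> borel_measurable M"
    and bound: "\<And>i x. i \<in> I \<Longrightarrow> x \<in> space M \<Longrightarrow> \<bar>Z i x\<bar> \<le> c"
    and mean: "\<And>i. i \<in> I \<Longrightarrow> expectation (Z i) = 0"
  obtains x where "x \<in> space M"
    "(\<Sum>i\<in>I. w i * (d i + Z i x)\<^sup>2) \<le> (\<Sum>i\<in>I. w i * (d i)\<^sup>2) + c\<^sup>2 * (\<Sum>i\<in>I. w i)"
proof -
  let ?B = "(\<Sum>i\<in>I. w i * (d i)\<^sup>2) + c\<^sup>2 * (\<Sum>i\<in>I. w i)"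
  let ?f = "\<lambda>x. \<Sum>i\<in>I. w i * (d i + Z i x)\<^sup>2"
  have int1: "integrable M (Z i)" if "i \<in> I" for i
    using that by (intro integrable_const_bound[of _ c] AE_I2 Z) (auto simp: bound)
  have sq: "(Z i x)\<^sup>2 \<le> c\<^sup>2" if "i \<in> I" "x \<in> space M" for i x
    using power_mono[OF bound[OF that], of 2] by simp
  have int2: "integrable M (\<lambda>x. (Z i x)\<^sup>2)" if "i \<in> I" for i
    using that Z[OF that] by (intro integrable_const_bound[of _ "c\<^sup>2"] AE_I2) (auto simp: sq)
  have le: "expectation (\<lambda>x. (d i + Z i x)\<^sup>2) \<le> (d i)\<^sup>2 + c\<^sup>2" if i: "i \<in> I" for i
  proof -
    have "expectation (\<lambda>x. (d i + Z i x)\<^sup>2) =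
        expectation (\<lambda>x. (d i)\<^sup>2 + 2 * d i * Z i x + (Z i x)\<^sup>2)"
      by (simp add: power2_sum algebra_simps)
    also have "\<dots> = (d i)\<^sup>2 + expectation (\<lambda>x. (Z i x)\<^sup>2)"
      using int1[OF i] int2[OF i] mean[OF i] by (simp add: prob_space)
    also have "expectation (\<lambda>x. (Z i x)\<^sup>2) \<le> expectation (\<lambda>_. c\<^sup>2)"
      using int2[OF i] sq[OF i] by (intro integral_mono) auto
    finally show ?thesis by (simp add: prob_space)
  qed
  have int3: "integrable M (\<lambda>x. (d i + Z i x)\<^sup>2)" if "i \<in> I" for i
    using int1[OF that] int2[OF that] by (simp add: power2_sum)
  have int: "integrable M ?f"
    using int3 by (intro Bochner_Integration.integrable_sum integrable_mult_right) auto
  have "expectation ?f = (\<Sum>i\<in>I. w i * expectation (\<lambda>x. (d i + Z i x)\<^sup>2))"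
    using int3 by simp
  also have "\<dots> \<le> (\<Sum>i\<in>I. w i * ((d i)\<^sup>2 + c\<^sup>2))"
    by (intro sum_mono mult_left_mono le w)
  also have "\<dots> = ?B"
    by (simp add: distrib_left sum.distrib sum_distrib_right mult.commute)
  finally have "expectation ?f \<le> ?B" .
  moreover have "\<exists>x\<in>space M. ?f x \<le> expectation ?f"
  proof (rule ccontr)
    assume "\<not> (\<exists>x\<in>space M. ?f x \<le> expectation ?f)"
    then have "AE x in M. expectation ?f < ?f x"
      by (intro AE_I2) (simp add: not_le)
    then have "expectation (\<lambda>_. expectation ?f) < expectation ?f"
      using int by (intro integral_less_AE_space) (simp_all add: emeasure_space_1)
    then show False by (simp add: prob_space)
  qed
  ultimately show thesis
    using that by fastforce
qed

text \<open>
  A derandomized law of large numbers. For independent \<open>x j\<close> the partial sums of \<open>Z j r (x j)\<close>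
  would have variance at most \<open>\<Sum>j<K. (c j)^2\<close>. The method of conditional expectations reaches a
  bound of this order for all \<open>K\<close> and all \<open>r\<close> at once: each point is chosen greedily to keep the
  potential \<open>\<Sum>r. (1/2)^r * (partial sum at r)^2\<close> small, and the weights are summable, so that a
  step costs at most \<open>2 * (c n)^2\<close>. The hypothesis that \<open>Z j r\<close> vanishes for \<open>r > j\<close> keeps
  the potential a finite sum at every stage.
\<close>

lemma (in prob_space) exists_balanced_sequence:
  fixes Z :: "nat \<Rightarrow> nat \<Rightarrow> 'a \<Rightarrow> real"
  assumes Z: "\<And>j r. Z j r \<in> borel_measurable M"
    and bound: "\<And>j r x. x \<in> space M \<Longrightarrow> \<bar>Z j r x\<bar> \<le> c j"
    and mean: "\<And>j r. expectation (Z j r) = 0"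
    and vanish: "\<And>j r x. j < r \<Longrightarrow> Z j r x = 0"
  obtains x where "\<And>j. x j \<in> space M"
    "\<And>K r. (\<Sum>j<K. Z j r (x j))\<^sup>2 \<le> 2 ^ r * (2 * (\<Sum>j<K. (c j)\<^sup>2))"
proof -
  \<comment> \<open>The state \<open>D\<close> of the greedy construction lists the current partial sums, one for each \<open>r\<close>.\<close>
  define P where "P n D \<longleftrightarrow> (\<forall>r\<ge>n. D r = 0) \<and> (\<Sum>r<n. (1/2)^r * (D r)\<^sup>2) \<le> 2 * (\<Sum>j<n. (c j)\<^sup>2)"
    for n and D :: "nat \<Rightarrow> real"
  define Q where "Q n D D' \<longleftrightarrow> (\<exists>x\<in>space M. \<forall>r. D' r = D r + Z n r x)"
    for n and D D' :: "nat \<Rightarrow> real"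
  have "\<exists>D. \<forall>n. (P n (D n) \<and> (n = 0 \<longrightarrow> D n = (\<lambda>_. 0))) \<and> Q n (D n) (D (Suc n))"
  proof (rule dependent_nat_choice)
    show "\<exists>D. P 0 D \<and> (0 = 0 \<longrightarrow> D = (\<lambda>_. 0))"
      by (auto simp: P_def)
    fix D n assume "P n D \<and> (n = 0 \<longrightarrow> D = (\<lambda>_. 0))"
    then have D0: "\<And>r. r \<ge> n \<Longrightarrow> D r = 0"
      and D: "(\<Sum>r<n. (1/2)^r * (D r)\<^sup>2) \<le> 2 * (\<Sum>j<n. (c j)\<^sup>2)"
      by (auto simp: P_def)
    obtain x where x: "x \<in> space M"
      and le: "(\<Sum>r<Suc n. (1/2)^r * (D r + Z n r x)\<^sup>2)
          \<le> (\<Sum>r<Suc n. (1/2)^r * (D r)\<^sup>2) + (c n)\<^sup>2 * (\<Sum>r<Suc n. (1/2)^r)"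
      by (rule exists_point_controlling_squares[of "{..<Suc n}" "\<lambda>r. (1/2)^r" "Z n" "c n" D])
        (use Z bound mean in auto)
    have "(\<Sum>r<Suc n. (1/2)^r * (D r)\<^sup>2) = (\<Sum>r<n. (1/2)^r * (D r)\<^sup>2)"
      by (simp add: D0)
    moreover have "(\<Sum>r<Suc n. (1/2)^r) \<le> (2::real)"
      by (simp add: geometric_sum del: sum.lessThan_Suc power_Suc)
    then have "(c n)\<^sup>2 * (\<Sum>r<Suc n. (1/2)^r) \<le> (c n)\<^sup>2 * 2"
      by (intro mult_left_mono) auto
    ultimately have "(\<Sum>r<Suc n. (1/2)^r * (D r + Z n r x)\<^sup>2) \<le> 2 * (\<Sum>j<Suc n. (c j)\<^sup>2)"
      using le D unfolding sum.lessThan_Suc[of "\<lambda>j. (c j)\<^sup>2"] distrib_left by linarith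
    then have "P (Suc n) (\<lambda>r. D r + Z n r x)"
      by (simp add: P_def D0 vanish)
    moreover have "Q n D (\<lambda>r. D r + Z n r x)"
      using x by (auto simp: Q_def)
    ultimately show "\<exists>D'. (P (Suc n) D' \<and> (Suc n = 0 \<longrightarrow> D' = (\<lambda>_. 0))) \<and> Q n D D'"
      by auto
  qed
  then obtain D where P: "\<And>n. P n (D n)" and D0: "D 0 = (\<lambda>_. 0)" and Q: "\<And>n. Q n (D n) (D (Suc n))"
    by auto
  have "\<forall>n. \<exists>x. x \<in> space M \<and> (\<forall>r. D (Suc n) r = D n r + Z n r x)"
    using Q by (auto simp: Q_def)
  then obtain x where x: "\<And>n. x n \<in> space M" and D_Suc: "\<And>n r. D (Suc n) r = D n r + Z n r (x n)"
    by metis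
  have D_eq: "D K r = (\<Sum>j<K. Z j r (x j))" for K r
    by (induction K) (simp_all add: D0 D_Suc)
  show thesis
  proof (rule that[OF x])
    fix K r
    let ?C = "2 * (\<Sum>j<K. (c j)\<^sup>2)"
    show "(\<Sum>j<K. Z j r (x j))\<^sup>2 \<le> 2 ^ r * ?C"
    proof (cases "r < K")
      case True
      have "(1/2)^r * (D K r)\<^sup>2 \<le> (\<Sum>r<K. (1/2)^r * (D K r)\<^sup>2)"
        using True by (intro member_le_sum) auto
      also have "\<dots> \<le> ?C"
        using P[of K] by (simp add: P_def)
      finally have "2 ^ r * ((1/2)^r * (D K r)\<^sup>2) \<le> 2 ^ r * ?C"
        by (intro mult_left_mono) auto
      then show ?thesis
        by (simp add: D_eq power_one_over)
    next
      case False
      then have "D K r = 0"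
        using P[of K] by (simp add: P_def)
      then show ?thesis
        by (simp add: D_eq[symmetric] sum_nonneg)
    qed
  qed
qed

section \<open>From systems to sets of integers\<close>

text \<open>
  Consecutive squares have ratio tending to one, and counting functions are monotone, so
  convergence of the densities along the squares forces convergence along all \<open>N\<close>.
\<close>

lemma upper_density_eq_limit_along_squares:
  assumes lim: "(\<lambda>K. real (card (E \<inter> {0..<K\<^sup>2})) / real (K\<^sup>2)) \<longlonglongrightarrow> m"
  shows "upper_density E = m"
proof -
  define c where "c N = real (card (E \<inter> {0..<N}))" for N
  define d where "d K = c (K\<^sup>2) / real (K\<^sup>2)" for K
  have d: "d \<longlonglongrightarrow> m"
    using lim by (simp add: d_def[abs_def] c_def)
  have c_mono: "c N \<le> c N'" if "N \<le> N'" for N N'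
    unfolding c_def using that by (intro of_nat_mono card_mono) auto
  have c_nonneg: "0 \<le> c N" for N
    by (simp add: c_def)
  let ?s = floor_sqrt
  have s: "filterlim ?s at_top sequentially"
    unfolding filterlim_at_top
    by (intro allI eventually_sequentiallyI) (rule le_floor_sqrtI)
  have lower_lim: "(\<lambda>K. d K * (real K / real (Suc K))\<^sup>2) \<longlonglongrightarrow> m * 1\<^sup>2"
    by (intro tendsto_mult d tendsto_power) real_asymp
  have upper_lim: "(\<lambda>K. d (Suc K) * (real (Suc K) / real K)\<^sup>2) \<longlonglongrightarrow> m * 1\<^sup>2"
    by (intro tendsto_mult tendsto_power LIMSEQ_Suc[OF d]) real_asymp
  have "(\<lambda>N. c N / real N) \<longlonglongrightarrow> m"
  proof (rule tendsto_sandwich)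
    show "(\<lambda>N. d (?s N) * (real (?s N) / real (Suc (?s N)))\<^sup>2) \<longlonglongrightarrow> m"
      using filterlim_compose[OF lower_lim s] by simp
    show "(\<lambda>N. d (Suc (?s N)) * (real (Suc (?s N)) / real (?s N))\<^sup>2) \<longlonglongrightarrow> m"
      using filterlim_compose[OF upper_lim s] by simp
    show "\<forall>\<^sub>F N in sequentially. d (?s N) * (real (?s N) / real (Suc (?s N)))\<^sup>2 \<le> c N / real N"
      using eventually_gt_at_top[of 0]
    proof eventually_elim
      fix N :: nat assume "N > 0"
      have "real N \<le> real ((Suc (?s N))\<^sup>2)"
        using Suc_floor_sqrt_power2_gt[of N] by linarith
      then have "c ((?s N)\<^sup>2) / real ((Suc (?s N))\<^sup>2) \<le> c N / real N"
        using \<open>N > 0\<close> by (intro frac_le c_mono c_nonneg) auto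
      moreover have "?s N > 0"
        using \<open>N > 0\<close> by simp
      ultimately show "d (?s N) * (real (?s N) / real (Suc (?s N)))\<^sup>2 \<le> c N / real N"
        by (simp add: d_def power_divide)
    qed
    show "\<forall>\<^sub>F N in sequentially. c N / real N \<le> d (Suc (?s N)) * (real (Suc (?s N)) / real (?s N))\<^sup>2"
      using eventually_gt_at_top[of 0]
    proof eventually_elim
      fix N :: nat assume "N > 0"
      then have "?s N > 0" by simp
      moreover have "c N / real N \<le> c ((Suc (?s N))\<^sup>2) / real ((?s N)\<^sup>2)"
        using \<open>?s N > 0\<close> Suc_floor_sqrt_power2_gt[of N] floor_sqrt_power2_le[of N]
        by (intro frac_le c_mono c_nonneg) (simp_all del: of_nat_power)
      ultimately show "c N / real N \<le> d (Suc (?s N)) * (real (Suc (?s N)) / real (?s N))\<^sup>2"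
        by (simp add: d_def power_divide del: of_nat_Suc)
    qed
  qed
  then have "(\<lambda>N. ereal (c N / real N)) \<longlonglongrightarrow> ereal m"
    by simp
  then have "limsup (\<lambda>N. ereal (c N / real N)) = ereal m"
    by (intro lim_imp_Limsup) auto
  then show ?thesis
    by (simp add: upper_density_def c_def)
qed

lemma sum_lessThan_square_blocks:
  fixes g :: "nat \<Rightarrow> 'b::comm_monoid_add"
  shows "(\<Sum>n<K\<^sup>2. g n) = (\<Sum>j<K. \<Sum>i<2 * j + 1. g (j\<^sup>2 + i))"
proof (induction K)
  case (Suc K)
  have split: "(\<Sum>n<m + k. g n) = (\<Sum>n<m. g n) + (\<Sum>i<k. g (m + i))" for m k
    by (induction k) (simp_all add: add.assoc)
  have "(Suc K)\<^sup>2 = K\<^sup>2 + (2 * K + 1)"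
    by (simp add: power2_eq_square)
  then show ?case
    by (simp only: split Suc.IH sum.lessThan_Suc)
qed simp

lemma floor_sqrt_in_block:
  assumes "i < 2 * j + 1"
  shows "floor_sqrt (j\<^sup>2 + i) = j"
  using assms by (intro floor_sqrt_unique) (auto simp: power2_eq_square)

text \<open>
  On the block \<open>[j^2, (j+1)^2)\<close> the set \<open>E\<close> records the visits to \<open>A\<close> of the first \<open>2 j + 1\<close>
  points of the orbit of \<open>x j\<close>. Up to at most \<open>r\<close> times at the end of each block, the times in
  \<open>E \<inter> (E - r)\<close> are the visits to \<open>B r = A \<inter> T^-r A\<close>. Their number \<open>Y j r\<close> inside the block has
  the right mean by invariance, and balanced points \<open>x j\<close> make the deviations \<open>Z j r (x j)\<close>
  add up to \<open>O(K powr (3/2))\<close> over \<open>K\<close> blocks, while the total length is \<open>K^2\<close>. The error from the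
  block ends is \<open>O(K)\<close>. Many starting points are essential: in a non-ergodic system a
  single orbit may see only a part of the space.
\<close>

theorem inverse_furstenberg_correspondence:
  assumes sys: "measure_preserving_system M T" and A: "A \<in> sets M"
  obtains E where "\<And>r. upper_density (E \<inter> shift_down E r) =
    measure M (A \<inter> ((T ^^ r) -` A \<inter> space M))"
proof -
  interpret prob_space M
    using sys by (simp add: measure_preserving_system_def)
  have T: "T \<in> measurable M M"
    and T_inv: "\<And>B. B \<in> sets M \<Longrightarrow> measure M (T -` B \<inter> space M) = measure M B"
    using sys by (simp_all add: measure_preserving_system_def)
  have Tn [measurable]: "(T ^^ n) \<in> measurable M M" for n
    by (induction n) (simp_all add: id_def measurable_comp[OF T] funpow_Suc_right del: funpow.simps(2) comp_apply)
  have Tn_space: "(T ^^ n) x \<in> space M" if "x \<in> space M" for n x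
    using measurable_space[OF Tn that] .
  have Tn_inv: "measure M ((T ^^ n) -` B \<inter> space M) = measure M B" if "B \<in> sets M" for n B
  proof (induction n)
    case 0
    show ?case using sets.sets_into_space[OF that] by (simp add: Int_absorb2)
  next
    case (Suc n)
    have "(T ^^ Suc n) -` B \<inter> space M = T -` ((T ^^ n) -` B \<inter> space M) \<inter> space M"
      using measurable_space[OF T] by (auto simp: funpow_Suc_right simp del: funpow.simps)
    then show ?case
      by (simp only: T_inv[OF measurable_sets[OF Tn that]] Suc.IH)
  qed
  define B where "B r = A \<inter> ((T ^^ r) -` A \<inter> space M)" for r
  define m where "m r = measure M (B r)" for r
  have B [measurable]: "B r \<in> sets M" for r
    unfolding B_def using A by measurable
  have m: "0 \<le> m r" "m r \<le> 1" for r
    by (simp_all add: m_def)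
  define Y where "Y j r x = (\<Sum>i<2 * j + 1 - r. indicator (B r) ((T ^^ i) x) :: real)" for j r x
  \<comment> \<open>The finitely many blocks with \<open>j < r\<close> do not affect densities; dropping them gives the
    vanishing that the balancing lemma asks for.\<close>
  define Z where "Z j r x = (if j < r then 0 else Y j r x - real (2 * j + 1 - r) * m r)" for j r x
  have Y_bounds: "0 \<le> Y j r x" "Y j r x \<le> real (2 * j + 1 - r)" for j r x
    unfolding Y_def using sum_bounded_above[of "{..<2 * j + 1 - r}" "\<lambda>i. indicator (B r) ((T ^^ i) x)" "1::real"]
    by (auto intro!: sum_nonneg simp: indicator_le_1)
  have m_prod: "0 \<le> real k * m r" "real k * m r \<le> real k" for k r
    using m[of r] by (auto intro: mult_left_le)
  have Y_meas: "Y j r \<in> borel_measurable M" for j r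
    unfolding Y_def[abs_def] by measurable
  have Y_mean: "expectation (Y j r) = real (2 * j + 1 - r) * m r" for j r
  proof -
    have "expectation (\<lambda>x. indicator (B r) ((T ^^ i) x)) = m r" for i
    proof -
      have "expectation (\<lambda>x. indicator (B r) ((T ^^ i) x)) =
          expectation (indicator ((T ^^ i) -` B r \<inter> space M) :: 'a \<Rightarrow> real)"
        by (intro Bochner_Integration.integral_cong) (auto simp: indicator_def)
      then show ?thesis
        using Tn_inv[OF B] by (simp add: m_def)
    qed
    moreover have "integrable M (\<lambda>x. indicator (B r) ((T ^^ i) x) :: real)" for i
      by (intro integrable_const_bound[of _ 1]) (auto simp: indicator_def)
    ultimately show ?thesis
      unfolding Y_def[abs_def] by simp
  qed
  have Y_int: "integrable M (Y j r)" for j r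
    using Y_bounds[of j r] Y_meas by (intro integrable_const_bound[of _ "real (2 * j + 1 - r)"]) auto
  obtain x where x: "\<And>j. x j \<in> space M"
    and balanced: "\<And>K r. (\<Sum>j<K. Z j r (x j))\<^sup>2 \<le> 2 ^ r * (2 * (\<Sum>j<K. (real (2 * j + 1))\<^sup>2))"
  proof (rule exists_balanced_sequence[of Z "\<lambda>j. real (2 * j + 1)"])
    show "Z j r \<in> borel_measurable M" for j r
      using Y_meas[of j r] by (simp add: Z_def[abs_def])
    show "\<bar>Z j r x\<bar> \<le> real (2 * j + 1)" for j r x
    proof -
      have "real (2 * j + 1 - r) \<le> real (2 * j + 1)" by (intro of_nat_mono) simp
      then have "\<bar>Y j r x - real (2 * j + 1 - r) * m r\<bar> \<le> real (2 * j + 1)"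
        using Y_bounds[of j r x] m_prod[of "2 * j + 1 - r" r] by linarith
      then show ?thesis by (cases "j < r") (simp_all only: Z_def if_True if_False abs_zero of_nat_0_le_iff)
    qed
    show "expectation (Z j r) = 0" for j r
      using Y_int[of j r] by (cases "j < r") (simp_all add: Z_def[abs_def] Y_mean prob_space del: of_nat_diff)
    show "Z j r x = 0" if "j < r" for j r x
      using that by (simp add: Z_def)
  qed (rule that)
  define E where "E = {n. (T ^^ (n - (floor_sqrt n)\<^sup>2)) (x (floor_sqrt n)) \<in> A}"
  have E_block: "j\<^sup>2 + i \<in> E \<longleftrightarrow> (T ^^ i) (x j) \<in> A" if "i < 2 * j + 1" for i j
    by (simp add: E_def floor_sqrt_in_block[OF that])
  have density: "(\<lambda>K. real (card (E \<inter> shift_down E r \<inter> {0..<K\<^sup>2})) / real (K\<^sup>2)) \<longlonglongrightarrow> m r" for r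
  proof -
    define g where "g n = (of_bool (n \<in> E \<inter> shift_down E r) :: real)" for n
    define b where "b j = (\<Sum>i<2 * j + 1. g (j\<^sup>2 + i))" for j
    have g: "0 \<le> g n" "g n \<le> 1" for n
      by (simp_all add: g_def)
    have g_sum: "0 \<le> (\<Sum>i<k. g (a + i))" "(\<Sum>i<k. g (a + i)) \<le> real k" for a k
      using sum_bounded_above[of "{..<k}" "\<lambda>i. g (a + i)" 1] g by (auto intro!: sum_nonneg)
    \<comment> \<open>Blocks with \<open>j < r\<close> have length at most \<open>2 * r\<close>; in longer ones the uncontrolled times are
      the last \<open>r\<close>.\<close>
    have block: "\<bar>b j - real (2 * j + 1) * m r - Z j r (x j)\<bar> \<le> 2 * real r" for j
    proof (cases "j < r")
      case True
      have "0 \<le> b j" "b j \<le> real (2 * j + 1)"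
        unfolding b_def by (rule g_sum)+
      moreover have "real (2 * j + 1) \<le> 2 * real r"
        using True by linarith
      moreover have "Z j r (x j) = 0"
        using True by (simp add: Z_def)
      ultimately show ?thesis
        using m_prod[of "2 * j + 1" r] by linarith
    next
      case False
      define k where "k = 2 * j + 1 - r"
      have k: "2 * j + 1 = k + r"
        using False by (simp add: k_def)
      have "(\<Sum>i<k. g (j\<^sup>2 + i)) = Y j r (x j)"
        unfolding Y_def k_def[symmetric]
      proof (rule sum.cong)
        fix i assume "i \<in> {..<k}"
        then have "i < 2 * j + 1" "i + r < 2 * j + 1"
          using k by auto
        then have "j\<^sup>2 + i \<in> E \<longleftrightarrow> (T ^^ i) (x j) \<in> A"
          "j\<^sup>2 + i + r \<in> E \<longleftrightarrow> (T ^^ r) ((T ^^ i) (x j)) \<in> A"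
          using E_block[of i j] E_block[of "i + r" j]
          by (simp_all add: add.assoc add.commute[of i r] funpow_add)
        then show "g (j\<^sup>2 + i) = indicator (B r) ((T ^^ i) (x j))"
          using Tn_space[OF x] by (simp add: g_def shift_down_def B_def indicator_def)
      qed simp
      moreover have "b j = (\<Sum>i<k. g (j\<^sup>2 + i)) + (\<Sum>i<r. g (j\<^sup>2 + k + i))"
        unfolding b_def k by (induction r) (simp_all add: add.assoc)
      moreover note g_sum[of "j\<^sup>2 + k" r]
      moreover have "Z j r (x j) = Y j r (x j) - real k * m r"
        using False by (simp add: Z_def k_def)
      moreover have "real (2 * j + 1) * m r = real k * m r + real r * m r"
        by (simp only: k of_nat_add distrib_right)
      ultimately show ?thesis
        using m_prod[of r r] by linarith
    qed
    have count: "real (card (E \<inter> shift_down E r \<inter> {0..<K\<^sup>2})) = (\<Sum>j<K. b j)" for K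
    proof -
      have "real (card (E \<inter> shift_down E r \<inter> {0..<K\<^sup>2})) = (\<Sum>n<K\<^sup>2. g n)"
        unfolding g_def by (simp add: Int_def lessThan_atLeast0 conj_ac)
      then show ?thesis
        by (simp only: sum_lessThan_square_blocks b_def)
    qed
    have "(\<Sum>j<K. 2 * j + 1) = K\<^sup>2" for K :: nat
      by (induction K) (simp_all add: power2_eq_square)
    then have squares: "(\<Sum>j<K. real (2 * j + 1) * m r) = real (K\<^sup>2) * m r" for K
      by (metis of_nat_sum sum_distrib_right)
    have err: "\<bar>(\<Sum>j<K. b j) - real (K\<^sup>2) * m r\<bar> \<le> sqrt (2 ^ (r + 3) * real K ^ 3) + 2 * real r * real K" for K
    proof -
      let ?D = "\<Sum>j<K. Z j r (x j)"
      have "(\<Sum>j<K. (real (2 * j + 1))\<^sup>2) \<le> (\<Sum>j<K. (2 * real K)\<^sup>2)"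
        by (intro sum_mono power_mono) auto
      then have "?D\<^sup>2 \<le> 2 ^ r * (2 * (\<Sum>j<K. (2 * real K)\<^sup>2))"
        by (intro order_trans[OF balanced] mult_left_mono) auto
      also have "\<dots> = 2 ^ (r + 3) * real K ^ 3"
        by (simp add: power2_eq_square power3_eq_cube power_add)
      finally have D: "\<bar>?D\<bar> \<le> sqrt (2 ^ (r + 3) * real K ^ 3)"
        by (rule real_le_rsqrt[of "\<bar>?D\<bar>", simplified])
      have "\<bar>(\<Sum>j<K. b j) - real (K\<^sup>2) * m r - ?D\<bar> = \<bar>\<Sum>j<K. b j - real (2 * j + 1) * m r - Z j r (x j)\<bar>"
        by (simp only: sum_subtractf squares)
      also have "\<dots> \<le> (\<Sum>j<K. 2 * real r)"
        by (intro order_trans[OF sum_abs] sum_mono block)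
      finally show ?thesis
        using D by (simp add: mult.commute abs_le_iff)
    qed
    have "(\<lambda>K. (\<Sum>j<K. b j) / real (K\<^sup>2) - m r) \<longlonglongrightarrow> 0"
    proof (rule Lim_null_comparison)
      show "\<forall>\<^sub>F K in sequentially. norm ((\<Sum>j<K. b j) / real (K\<^sup>2) - m r)
          \<le> (sqrt (2 ^ (r + 3) * real K ^ 3) + 2 * real r * real K) / real (K\<^sup>2)"
        using eventually_gt_at_top[of 0]
      proof eventually_elim
        fix K :: nat assume "K > 0"
        then have "(\<Sum>j<K. b j) / real (K\<^sup>2) - m r = ((\<Sum>j<K. b j) - real (K\<^sup>2) * m r) / real (K\<^sup>2)"
          by (simp add: field_simps)
        then show "norm ((\<Sum>j<K. b j) / real (K\<^sup>2) - m r)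
            \<le> (sqrt (2 ^ (r + 3) * real K ^ 3) + 2 * real r * real K) / real (K\<^sup>2)"
          using err[of K] by (simp add: abs_divide divide_right_mono)
      qed
      have "0 < (2::real) ^ (r + 3)" by simp
      then show "(\<lambda>K. (sqrt (2 ^ (r + 3) * real K ^ 3) + 2 * real r * real K) / real (K\<^sup>2)) \<longlonglongrightarrow> 0"
        by real_asymp
    qed
    then show ?thesis
      unfolding count by (rule LIM_zero_cancel)
  qed
  show thesis
    using upper_density_eq_limit_along_squares[OF density] by (intro that[of E]) (simp add: m_def B_def)
qed

section \<open>The equivalence\<close>

lemma nice_recurrence_imp_nicely_intersective:
  assumes "nice_recurrence TYPE(nat \<Rightarrow> bool) R"
  shows "nicely_intersective R"
  unfolding nicely_intersective_def
proof (intro allI impI)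
  fix E :: "nat set" and \<epsilon> :: real
  assume "0 < \<epsilon>"
  obtain M A where sys: "measure_preserving_system M left_shift" "A \<in> sets M"
    and A: "measure M A = upper_density E"
    and le: "\<And>r. measure M (A \<inter> ((left_shift ^^ r) -` A \<inter> space M)) \<le> upper_density (E \<inter> shift_down E r)"
    by (rule furstenberg_correspondence[of E]) (rule that)
  obtain r where r: "r \<in> R" "r \<noteq> 0"
    and "measure M (A \<inter> ((left_shift ^^ r) -` A \<inter> space M)) > (measure M A)\<^sup>2 - \<epsilon>"
    using assms[unfolded nice_recurrence_def, rule_format, OF sys \<open>0 < \<epsilon>\<close>] by (elim bexE conjE)
  then have "upper_density (E \<inter> shift_down E r) > (upper_density E)\<^sup>2 - \<epsilon>"
    using le[of r] unfolding A by linarith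
  with r show "\<exists>r\<in>R. r \<noteq> 0 \<and> upper_density (E \<inter> shift_down E r) > (upper_density E)\<^sup>2 - \<epsilon>"
    by (intro bexI conjI)
qed

lemma nicely_intersective_imp_nice_recurrence:
  assumes "nicely_intersective R"
  shows "nice_recurrence TYPE('a) R"
  unfolding nice_recurrence_def
proof (intro allI impI)
  fix M :: "'a measure" and T A and \<epsilon> :: real
  assume sys: "measure_preserving_system M T" "A \<in> sets M" and "0 < \<epsilon>"
  obtain E where E: "\<And>r. upper_density (E \<inter> shift_down E r) =
      measure M (A \<inter> ((T ^^ r) -` A \<inter> space M))"
    by (rule inverse_furstenberg_correspondence[OF sys]) (rule that)
  have "E \<inter> shift_down E 0 = E" "A \<inter> ((T ^^ 0) -` A \<inter> space M) = A"
    using sets.sets_into_space[OF sys(2)] by (auto simp: shift_down_def)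
  then have "upper_density E = measure M A"
    using E[of 0] by simp
  with assms[unfolded nicely_intersective_def, rule_format, OF \<open>0 < \<epsilon>\<close>, of E]
  show "\<exists>r\<in>R. r \<noteq> 0 \<and> measure M (A \<inter> ((T ^^ r) -` A \<inter> space M)) > (measure M A)\<^sup>2 - \<epsilon>"
    by (simp only: E)
qed

theorem theorem1p3:
  fixes R :: "nat set"
  shows "(nice_recurrence TYPE(nat \<Rightarrow> bool) R \<longleftrightarrow> nicely_intersective R) \<and>
         (nicely_intersective R \<longrightarrow> nice_recurrence TYPE('a) R)"
  by (intro conjI iffI impI)
    (erule nice_recurrence_imp_nicely_intersective nicely_intersective_imp_nice_recurrence)+

end
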